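(* If $n \geq 3$, then the minimum modulus $m_n$ of a reliability root of a connected loopless graph of order $n$ is $\frac{1}{n-1}$, the cycle $C_n$ is (up to isomorphism) the only connected loopless graph of that order that has a reliability root of this modulus, and $C_n$ has only one reliability root of this modulus, namely $-\frac{1}{n-1}$. If $n = 2$, then the set of reliability roots of smallest modulus of connected loopless graphs of order $2$ is the set of all $m$-th roots of unity, over all integers $m \geq 1$.
   Context: All graphs are finite, undirected, connected and loopless, possibly with multiple edges. The order of a graph is its number of vertices. For a connected graph $G$ with vertex set $V$ and edge (multi)set $E$, the (all-terminal) reliability of $G$ is the probability that the operational edges form a connected spanning subgraph, when vertices always operate and each edge fails independently with probability $q$. It is the polynomial $\mathrm{Rel}(G,q) = \sum_{S} (1-q)^{|S|} q^{|E|-|S|}$, where the sum is over all $S \subseteq E$ such that the spanning subgraph $(V,S)$ is connected. A reliability root of $G$ is a complex number $z$ with $\mathrm{Rel}(G,z)=0$. For $n \ge 2$, $m_n$ denotes the minimum modulus $|z|$ of a reliability root $z$ over all connected graphs of order $n$ (with any number of edges); a reliability root of smallest modulus (for order $n$) is a reliability root $z$ of some connected graph of order $n$ with $|z| = m_n$. $C_n$ is the cycle graph on $n$ vertices. *)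

theory Defs
  imports Complex_Main "HOL-Computational_Algebra.Polynomial"
begin

text \<open>
  Undirected multigraphs with labelled edges: \<open>ends G e\<close> is the set of end vertices of \<open>e\<close>.
  Distinct labels with the same set of end vertices are parallel edges. The values of \<open>ends G\<close>
  outside \<open>edges G\<close> are irrelevant.
\<close>

record ('v, 'e) multigraph =
  verts :: "'v set"
  edges :: "'e set"
  ends :: "'e \<Rightarrow> 'v set"

text \<open>Looplessness is the condition that every edge has two distinct end vertices.\<close>

definition loopless_multigraph :: "('v, 'e) multigraph \<Rightarrow> bool" where
  "loopless_multigraph G \<longleftrightarrow> finite (verts G) \<and> finite (edges G) \<and>
     (\<forall>e \<in> edges G. ends G e \<subseteq> verts G \<and> card (ends G e) = 2)"

abbreviation graph_order :: "('v, 'e) multigraph \<Rightarrow> nat" where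
  "graph_order G \<equiv> card (verts G)"

definition adjacency :: "('v, 'e) multigraph \<Rightarrow> ('v \<times> 'v) set" where
  "adjacency G = {(u, v). \<exists>e \<in> edges G. ends G e = {u, v}}"

definition connected_multigraph :: "('v, 'e) multigraph \<Rightarrow> bool" where
  "connected_multigraph G \<longleftrightarrow> verts G \<noteq> {} \<and> (\<forall>u \<in> verts G. \<forall>v \<in> verts G. (u, v) \<in> (adjacency G)\<^sup>*)"

definition spanning_subgraph :: "('v, 'e) multigraph \<Rightarrow> 'e set \<Rightarrow> ('v, 'e) multigraph" where
  "spanning_subgraph G S = G\<lparr>edges := S\<rparr>"

text \<open>The polynomial \<open>[:1, -1:]\<close> is \<open>1 - q\<close> and \<open>[:0, 1:]\<close> is \<open>q\<close>.\<close>

definition reliability :: "('v, 'e) multigraph \<Rightarrow> complex poly" where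
  "reliability G = (\<Sum>S \<in> {S. S \<subseteq> edges G \<and> connected_multigraph (spanning_subgraph G S)}.
     [:1, -1:] ^ card S * [:0, 1:] ^ (card (edges G) - card S))"

definition reliability_root :: "('v, 'e) multigraph \<Rightarrow> complex \<Rightarrow> bool" where
  "reliability_root G z \<longleftrightarrow> poly (reliability G) z = 0"

definition multigraph_iso :: "('v, 'e) multigraph \<Rightarrow> ('w, 'f) multigraph \<Rightarrow> bool" where
  "multigraph_iso G H \<longleftrightarrow> (\<exists>f g. bij_betw f (verts G) (verts H) \<and> bij_betw g (edges G) (edges H) \<and>
     (\<forall>e \<in> edges G. ends H (g e) = f ` ends G e))"

text \<open>The cycle on \<open>n\<close> vertices, meant for \<open>n \<ge> 3\<close>.\<close>

definition cycle :: "nat \<Rightarrow> (nat, nat) multigraph" where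
  "cycle n = \<lparr>verts = {..<n}, edges = {..<n}, ends = (\<lambda>i. {i, Suc i mod n})\<rparr>"

text \<open>
  To range over all connected graphs of order \<open>n\<close> it suffices to use natural numbers as vertices
  and edge labels, see \<open>root_of_orderI\<close> below.
\<close>

definition root_of_order :: "nat \<Rightarrow> complex \<Rightarrow> bool" where
  "root_of_order n z \<longleftrightarrow> (\<exists>G :: (nat, nat) multigraph. loopless_multigraph G \<and>
     connected_multigraph G \<and> graph_order G = n \<and> reliability_root G z)"

text \<open>
  The infimum is over a nonempty set of nonnegative reals for \<open>n \<ge> 2\<close>. It is a minimum
  exactly if \<open>smallest_root_of_order n z\<close> holds for some \<open>z\<close>.
\<close>

definition min_root_modulus :: "nat \<Rightarrow> real" where
  "min_root_modulus n = Inf {cmod z | z. root_of_order n z}"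

definition smallest_root_of_order :: "nat \<Rightarrow> complex \<Rightarrow> bool" where
  "smallest_root_of_order n z \<longleftrightarrow> root_of_order n z \<and> cmod z = min_root_modulus n"

lemma multigraph_iso_connected:
  fixes G :: "('v, 'e) multigraph" and H :: "('w, 'f) multigraph"
  assumes f: "bij_betw f (verts G) (verts H)"
    and ends: "\<forall>e \<in> S. ends H (g e) = f ` ends G e"
    and sub: "\<forall>e \<in> S. ends G e \<subseteq> verts G"
  shows "connected_multigraph (spanning_subgraph H (g ` S)) \<longleftrightarrow>
         connected_multigraph (spanning_subgraph G S)"
proof -
  let ?A = "adjacency (spanning_subgraph G S)" and ?B = "adjacency (spanning_subgraph H (g ` S))"
  have inj: "inj_on f (verts G)" and img: "f ` verts G = verts H"
    using f by (auto simp: bij_betw_def)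
  have fwd: "(f u, f v) \<in> ?B\<^sup>*" if "(u, v) \<in> ?A\<^sup>*" for u v
    using that
  proof (induction rule: rtrancl_induct)
    case (step y z)
    then obtain e where "e \<in> S" "ends G e = {y, z}"
      by (auto simp: adjacency_def spanning_subgraph_def)
    then have "(f y, f z) \<in> ?B"
      using ends by (auto simp: adjacency_def spanning_subgraph_def)
    then show ?case using step.IH by simp
  qed simp
  have bwd: "\<exists>v \<in> verts G. y = f v \<and> (u, v) \<in> ?A\<^sup>*" if "(f u, y) \<in> ?B\<^sup>*" "u \<in> verts G" for u y
    using that(1)
  proof (induction rule: rtrancl_induct)
    case base
    then show ?case using that(2) by blast
  next
    case (step y z)
    then obtain e v where e: "e \<in> S" "ends H (g e) = {y, z}"
      and v: "v \<in> verts G" "y = f v" "(u, v) \<in> ?A\<^sup>*"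
      by (auto simp: adjacency_def spanning_subgraph_def)
    have im: "f ` ends G e = {f v, z}" and es: "ends G e \<subseteq> verts G"
      using e v ends sub by auto
    obtain w where w: "w \<in> ends G e" "z = f w"
      using im by blast
    obtain v' where v': "v' \<in> ends G e" "f v = f v'"
      using im by blast
    have "v' = v"
      using v' v(1) es inj by (metis inj_onD subsetD)
    have "ends G e = {v, w}"
    proof
      show "{v, w} \<subseteq> ends G e" using w v' \<open>v' = v\<close> by auto
      show "ends G e \<subseteq> {v, w}"
      proof
        fix x assume x: "x \<in> ends G e"
        then have "f x = f v \<or> f x = f w" using im w by auto
        then show "x \<in> {v, w}" using x w(1) v(1) es inj by (metis inj_onD insertCI subsetD)
      qed
    qed
    then have "(v, w) \<in> ?A"
      using e(1) by (auto simp: adjacency_def spanning_subgraph_def)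
    then have "(u, w) \<in> ?A\<^sup>*" using v(3) by simp
    moreover have "w \<in> verts G" using w(1) es by blast
    ultimately show ?case using w(2) by blast
  qed
  have iff: "(f u, f v) \<in> ?B\<^sup>* \<longleftrightarrow> (u, v) \<in> ?A\<^sup>*" if uv: "u \<in> verts G" "v \<in> verts G" for u v
  proof
    assume "(f u, f v) \<in> ?B\<^sup>*"
    then obtain w where "w \<in> verts G" "f v = f w" "(u, w) \<in> ?A\<^sup>*"
      using bwd[OF _ uv(1)] by blast
    then show "(u, v) \<in> ?A\<^sup>*" using uv inj by (simp add: inj_on_eq_iff)
  qed (rule fwd)
  show ?thesis
    unfolding connected_multigraph_def using iff
    by (simp add: spanning_subgraph_def flip: img)
qed

lemma multigraph_iso_invariance:
  fixes G :: "('v, 'e) multigraph" and H :: "('w, 'f) multigraph"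
  assumes "multigraph_iso G H" "loopless_multigraph G"
  shows "loopless_multigraph H" "graph_order H = graph_order G"
    "connected_multigraph H \<longleftrightarrow> connected_multigraph G" "reliability H = reliability G"
proof -
  obtain f g where f: "bij_betw f (verts G) (verts H)" and g: "bij_betw g (edges G) (edges H)"
    and ends: "\<forall>e \<in> edges G. ends H (g e) = f ` ends G e"
    using assms(1) by (auto simp: multigraph_iso_def)
  have injf: "inj_on f (verts G)" and injg: "inj_on g (edges G)"
    and imgf: "f ` verts G = verts H" and imgg: "g ` edges G = edges H"
    using f g by (auto simp: bij_betw_def)
  have sub: "\<forall>e \<in> edges G. ends G e \<subseteq> verts G" and two: "\<forall>e \<in> edges G. card (ends G e) = 2"
    and fin: "finite (verts G)" "finite (edges G)"
    using assms(2) by (simp_all add: loopless_multigraph_def)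
  have "ends H e \<subseteq> verts H \<and> card (ends H e) = 2" if e: "e \<in> edges H" for e
  proof -
    obtain d where d: "d \<in> edges G" "e = g d"
      using e imgg by blast
    have "card (f ` ends G d) = card (ends G d)"
      using injf sub d by (metis card_image inj_on_subset)
    then show ?thesis
      using d(1) two sub unfolding d(2) imgf[symmetric] bspec[OF ends d(1)] by (simp add: image_mono)
  qed
  then show "loopless_multigraph H"
    using fin by (simp add: loopless_multigraph_def flip: imgf imgg)
  show "graph_order H = graph_order G"
    using f by (simp add: bij_betw_same_card)
  have conn: "connected_multigraph (spanning_subgraph H (g ` S)) \<longleftrightarrow>
      connected_multigraph (spanning_subgraph G S)" if "S \<subseteq> edges G" for S
    by (rule multigraph_iso_connected[OF f]) (use ends sub that in auto)
  from conn[of "edges G"] show "connected_multigraph H \<longleftrightarrow> connected_multigraph G"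
    by (simp add: spanning_subgraph_def imgg)
  let ?X = "{S. S \<subseteq> edges G \<and> connected_multigraph (spanning_subgraph G S)}"
  let ?Y = "{S. S \<subseteq> edges H \<and> connected_multigraph (spanning_subgraph H S)}"
  have Y: "?Y = (`) g ` ?X"
  proof (intro equalityI subsetI)
    fix T assume T: "T \<in> ?Y"
    then obtain S where "S \<subseteq> edges G" "T = g ` S"
      unfolding imgg[symmetric] by (auto elim!: subset_imageE)
    then show "T \<in> (`) g ` ?X" using T conn by auto
  qed (auto simp: conn simp flip: imgg)
  have inj: "inj_on ((`) g) ?X"
    by (rule inj_on_subset[OF inj_on_image_Pow[OF injg]]) auto
  have cE: "card (edges H) = card (edges G)" using g by (simp add: bij_betw_same_card)
  show "reliability H = reliability G"
    unfolding reliability_def Y sum.reindex[OF inj] comp_def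
  proof (rule sum.cong[OF refl])
    fix S assume "S \<in> ?X"
    then have "card (g ` S) = card S"
      using injg by (metis (no_types, lifting) card_image inj_on_subset mem_Collect_eq)
    then show "[:1, -1:] ^ card (g ` S) * [:0, 1:] ^ (card (edges H) - card (g ` S)) =
      ([:1, -1:] ^ card S * [:0, 1:] ^ (card (edges G) - card S) :: complex poly)"
      by (simp add: cE)
  qed
qed

lemma multigraph_iso_nat:
  assumes "loopless_multigraph (G :: ('v, 'e) multigraph)"
  shows "\<exists>H :: (nat, nat) multigraph. multigraph_iso G H"
proof -
  obtain f :: "'v \<Rightarrow> nat" where f: "inj_on f (verts G)"
    using assms finite_imp_inj_to_nat_seg unfolding loopless_multigraph_def by metis
  obtain g :: "'e \<Rightarrow> nat" where g: "inj_on g (edges G)"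
    using assms finite_imp_inj_to_nat_seg unfolding loopless_multigraph_def by metis
  let ?H = "\<lparr>verts = f ` verts G, edges = g ` edges G,
    ends = (\<lambda>e. f ` ends G (inv_into (edges G) g e))\<rparr>"
  have "multigraph_iso G ?H"
    unfolding multigraph_iso_def
    by (rule exI[of _ f], rule exI[of _ g]) (use f g in \<open>auto simp: bij_betw_def\<close>)
  then show ?thesis by blast
qed

lemma root_of_orderI:
  fixes G :: "('v, 'e) multigraph"
  assumes "loopless_multigraph G" "connected_multigraph G" "reliability_root G z"
  shows "root_of_order (graph_order G) z"
proof -
  obtain H :: "(nat, nat) multigraph" where H: "multigraph_iso G H"
    using multigraph_iso_nat[OF assms(1)] by blast
  show ?thesis
    using multigraph_iso_invariance[OF H assms(1)] assms
    unfolding root_of_order_def reliability_root_def by metis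
qed

end

theory Submission
  imports Defs
begin

text \<open>
  Write the reliability polynomial of a connected graph \<open>G\<close> of order \<open>n\<close> as
  \<open>(1 - q)\<^sup>n\<^sup>-\<^sup>1 H(q)\<close>. The polynomial \<open>H = h\<^sub>0 + h\<^sub>1 q + \<dots>\<close> is the h-polynomial of the simplicial complex of
  edge sets whose removal leaves \<open>G\<close> connected. Its coefficients are nonnegative, \<open>h\<^sub>0 = 1\<close>, and they
  grow slowly: \<open>h\<^sub>i\<^sub>+\<^sub>1 \<le> (n - 1) h\<^sub>i\<close>. By the theorem of Enestrom and Kakeya, no root of \<open>H\<close> has modulus
  less than \<open>1/(n - 1)\<close>, and the other factor vanishes only at \<open>1\<close>.

  The growth bound has a short proof by induction over deletion and contraction. If \<open>e\<close> joins two
  different vertices, then \<open>H(G) = q H(G - e) + H(G/e)\<close> (lemma \<open>hpoly_link\<close>), where \<open>H = 0\<close> for a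
  disconnected graph. The bound \<open>n - 1\<close> for \<open>G - e\<close> and the bound \<open>n - 2\<close> for \<open>G/e\<close>, which has one vertex
  less, combine to the bound \<open>n - 1\<close> for \<open>G\<close>; in degree \<open>1\<close> the summand \<open>h\<^sub>0(G - e) \<le> 1\<close> makes up for the
  difference. The gain from the contracted graph shows moreover that the bound is strict for \<open>i \<ge> 1\<close>
  and \<open>n \<ge> 3\<close> unless \<open>h\<^sub>i = 0\<close> (lemma \<open>coeff_hpoly_growth_strict\<close>).

  Let \<open>z\<close> be a root of modulus at most \<open>1/(n - 1)\<close> and \<open>w = (n - 1) z\<close>. The equality case of the
  Enestrom-Kakeya argument gives \<open>w\<^sup>i\<^sup>+\<^sup>1 = 1\<close> whenever \<open>h\<^sub>i\<^sub>+\<^sub>1 < (n - 1) h\<^sub>i\<close>. Here \<open>w \<noteq> 1\<close>, because \<open>H\<close> is positive on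
  the positive reals. This forces \<open>h\<^sub>1 = n - 1\<close>, then \<open>w\<^sup>2 = 1\<close> by strictness, and then \<open>h\<^sub>2 = 0\<close>, as otherwise
  also \<open>w\<^sup>3 = 1\<close>. Hence \<open>H = 1 + (n - 1) q\<close> and \<open>z = -1/(n - 1)\<close>. Since \<open>h\<^sub>1 = n - 1\<close>, the graph has no bridge, and
  since \<open>h\<^sub>2 = 0\<close>, it becomes disconnected when any two edges are deleted. Such a graph is a cycle: an
  edge together with a shortest path around it leaves no room for other edges. Conversely, a spanning
  subgraph of the cycle is connected exactly if it lacks at most one edge, so \<open>H(C\<^sub>n) = 1 + (n - 1) q\<close>.

  In a graph of order \<open>2\<close> with \<open>m\<close> edges, only the empty edge set fails to connect the two
  vertices, so the reliability polynomial is \<open>1 - q\<^sup>m\<close>.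
\<close>

section \<open>Polynomials with slowly growing coefficients\<close>

lemma map_poly_of_real_mult:
  "map_poly complex_of_real (p * q) = map_poly complex_of_real p * map_poly complex_of_real q"
  by (intro poly_eqI) (simp add: coeff_map_poly coeff_mult)

lemma map_poly_of_real_power:
  "map_poly complex_of_real (p ^ k) = map_poly complex_of_real p ^ k"
  by (induction k) (simp_all add: map_poly_of_real_mult)

lemma map_poly_of_real_sum:
  "map_poly complex_of_real (\<Sum>x\<in>A. f x) = (\<Sum>x\<in>A. map_poly complex_of_real (f x))"
  by (intro poly_eqI) (simp add: coeff_map_poly coeff_sum)

lemma poly_of_real_sum:
  "poly (map_poly complex_of_real p) z = (\<Sum>i\<le>degree p. of_real (coeff p i) * z ^ i)"
  by (simp add: poly_altdef degree_map_poly coeff_map_poly)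

text \<open>
  Multiplying a polynomial by \<open>K z - 1\<close> turns the growth bound \<open>c\<^sub>i\<^sub>+\<^sub>1 \<le> K c\<^sub>i\<close> into the nonnegativity of all
  coefficients but the constant one. The identity is used twice below, at a complex root and at the
  real point \<open>1/K\<close>.
\<close>

lemma sum_times_linear:
  fixes c :: "nat \<Rightarrow> 'a :: comm_ring_1"
  assumes "c (Suc N) = 0"
  shows "(\<Sum>i\<le>N. (K * c i - c (Suc i)) * z ^ Suc i) = (K * z - 1) * (\<Sum>i\<le>N. c i * z ^ i) + c 0"
proof -
  have "(\<Sum>i\<le>N. c (Suc i) * z ^ Suc i) + c 0 = (\<Sum>i\<le>N. c i * z ^ i)"
    using sum.atMost_Suc_shift[of "\<lambda>i. c i * z ^ i" N] assms by simp
  then show ?thesis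
    by (simp add: algebra_simps sum_subtractf sum_distrib_left)
qed

text \<open>
  With \<open>w = K z\<close>, the identity above presents \<open>1\<close> as a convex combination of the powers \<open>w\<^sup>j\<^sup>+\<^sup>1\<close>, which lie
  in the closed unit disc. As \<open>1\<close> is an extreme point of the disc, every power of positive weight is
  equal to \<open>1\<close>; the weight of \<open>w\<^sup>j\<^sup>+\<^sup>1\<close> is positive exactly if the growth bound is strict at \<open>j\<close>.
\<close>

lemma Enestrom_Kakeya_boundary:
  fixes p :: "real poly" and K :: real and z :: complex
  assumes K: "K > 0"
    and growth: "\<And>i. coeff p (Suc i) \<le> K * coeff p i"
    and one: "coeff p 0 = 1"
    and root: "poly (map_poly of_real p) z = 0" and small: "cmod z \<le> 1 / K"
    and strict: "coeff p (Suc i) < K * coeff p i"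
  shows "(of_real K * z) ^ Suc i = 1"
proof -
  define N where "N = degree p"
  define d where "d j = (K * coeff p j - coeff p (Suc j)) * (1 / K) ^ Suc j" for j
  define w where "w = of_real K * z"
  have d_nonneg: "d j \<ge> 0" for j
    using growth[of j] K by (simp add: d_def)
  have d_pos: "d i > 0" using strict K by (simp add: d_def)
  have "i \<le> N"
    using strict coeff_eq_0[of p i] coeff_eq_0[of p "Suc i"] by (force simp: N_def)
  have w: "cmod w \<le> 1"
    using small K by (simp add: w_def norm_mult field_simps)
  \<comment> \<open>the identity at the real point \<open>1/K\<close>, where its linear factor vanishes\<close>
  have "(\<Sum>j\<le>N. d j) = 1"
    unfolding d_def using sum_times_linear[of "coeff p" N K "1 / K"] K one
    by (simp add: coeff_eq_0 N_def)
  \<comment> \<open>the identity at the root \<open>z\<close>\<close>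
  moreover have "(\<Sum>j\<le>N. of_real (d j) * w ^ Suc j) = 1"
  proof -
    have "of_real (d j) * w ^ Suc j =
        (of_real K * of_real (coeff p j) - of_real (coeff p (Suc j))) * z ^ Suc j" for j
      using K by (simp add: d_def w_def power_mult_distrib power_divide)
    then show ?thesis
      using sum_times_linear[of "\<lambda>j. complex_of_real (coeff p j)" N "of_real K" z] root one
      by (simp add: coeff_eq_0 N_def poly_of_real_sum)
  qed
  then have "Re (\<Sum>j\<le>N. of_real (d j) * w ^ Suc j) = 1"
    by simp
  then have "(\<Sum>j\<le>N. d j * Re (w ^ Suc j)) = 1"
    by (simp del: power_Suc)
  ultimately have "(\<Sum>j\<le>N. d j * (1 - Re (w ^ Suc j))) = 0"
    by (simp only: right_diff_distrib sum_subtractf mult_1_right diff_self)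
  moreover have cm: "cmod (w ^ Suc j) \<le> 1" for j
    using w by (simp only: norm_power power_le_one norm_ge_zero)
  then have "d j * (1 - Re (w ^ Suc j)) \<ge> 0" for j
    using d_nonneg[of j] complex_Re_le_cmod[of "w ^ Suc j"] cm[of j]
    by (intro mult_nonneg_nonneg) linarith+
  ultimately have "d i * (1 - Re (w ^ Suc i)) = 0"
    using \<open>i \<le> N\<close> by (subst (asm) sum_nonneg_eq_0_iff) auto
  then have re: "Re (w ^ Suc i) = 1" using d_pos by simp
  have "(Re (w ^ Suc i))\<^sup>2 + (Im (w ^ Suc i))\<^sup>2 \<le> 1"
    using cm[of i] power_le_one[of "cmod (w ^ Suc i)" 2] by (simp only: cmod_power2 norm_ge_zero)
  then have "Im (w ^ Suc i) = 0" unfolding re by simp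
  then show ?thesis using re by (simp add: complex_eq_iff w_def)
qed

section \<open>Deletion and contraction\<close>

text \<open>
  Loops are admitted, because contracting an edge turns its parallel edges into loops.
\<close>

definition wf_multigraph :: "('v, 'e) multigraph \<Rightarrow> bool" where
  "wf_multigraph G \<longleftrightarrow> finite (verts G) \<and> verts G \<noteq> {} \<and> finite (edges G) \<and>
     (\<forall>e \<in> edges G. \<exists>u \<in> verts G. \<exists>v \<in> verts G. ends G e = {u, v})"

definition delete :: "('v, 'e) multigraph \<Rightarrow> 'e \<Rightarrow> ('v, 'e) multigraph" where
  "delete G e = spanning_subgraph G (edges G - {e})"

definition merge :: "'v \<Rightarrow> 'v \<Rightarrow> 'v \<Rightarrow> 'v" where
  "merge u v x = (if x = v then u else x)"

text \<open>
  Meant for \<open>ends G e = {u, v}\<close>: the vertex \<open>v\<close> is identified with \<open>u\<close>, so that the vertex type is kept.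
\<close>

definition contract :: "('v, 'e) multigraph \<Rightarrow> 'e \<Rightarrow> 'v \<Rightarrow> 'v \<Rightarrow> ('v, 'e) multigraph" where
  "contract G e u v = \<lparr>verts = merge u v ` verts G, edges = edges G - {e},
     ends = (\<lambda>f. merge u v ` ends G f)\<rparr>"

lemma spanning_subgraph_sel [simp]:
  "verts (spanning_subgraph G S) = verts G" "edges (spanning_subgraph G S) = S"
  "ends (spanning_subgraph G S) = ends G"
  by (simp_all add: spanning_subgraph_def)

lemma spanning_subgraph_twice [simp]:
  "spanning_subgraph (spanning_subgraph G S) T = spanning_subgraph G T"
  by (simp add: spanning_subgraph_def)

lemma delete_sel [simp]:
  "verts (delete G e) = verts G" "edges (delete G e) = edges G - {e}" "ends (delete G e) = ends G"
  by (simp_all add: delete_def)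

lemma contract_sel [simp]:
  "verts (contract G e u v) = merge u v ` verts G" "edges (contract G e u v) = edges G - {e}"
  "ends (contract G e u v) f = merge u v ` ends G f"
  by (simp_all add: contract_def)

lemma spanning_subgraph_delete [simp]:
  "spanning_subgraph (delete G e) S = spanning_subgraph G S"
  by (simp add: delete_def)

lemma spanning_subgraph_edges [simp]: "spanning_subgraph G (edges G) = G"
  by (simp add: spanning_subgraph_def)

lemma merge_image:
  assumes "u \<in> V" "u \<noteq> v"
  shows "merge u v ` V = V - {v}"
  using assms by (auto simp: merge_def image_iff)

lemma order_pos: "wf_multigraph G \<Longrightarrow> graph_order G \<ge> 1"
  by (simp add: wf_multigraph_def Suc_le_eq card_gt_0_iff)

lemma wf_delete: "wf_multigraph G \<Longrightarrow> wf_multigraph (delete G e)"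
  by (simp add: wf_multigraph_def)

lemma wf_contract:
  assumes "wf_multigraph G"
  shows "wf_multigraph (contract G e u v)"
proof -
  have "\<exists>a \<in> merge u v ` verts G. \<exists>b \<in> merge u v ` verts G. merge u v ` ends G f = {a, b}"
    if f: "f \<in> edges G" for f
  proof -
    obtain a b where "a \<in> verts G" "b \<in> verts G" "ends G f = {a, b}"
      using assms f unfolding wf_multigraph_def by blast
    then show ?thesis by (intro bexI[of _ "merge u v a"] bexI[of _ "merge u v b"]) auto
  qed
  then show ?thesis using assms by (auto simp: wf_multigraph_def)
qed

lemma order_contract:
  assumes "wf_multigraph G" "e \<in> edges G" "ends G e = {u, v}" "u \<noteq> v"
  shows "graph_order G = Suc (graph_order (contract G e u v))"
proof -
  have uv: "u \<in> verts G" "v \<in> verts G" and fin: "finite (verts G)"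
    using assms by (auto simp: wf_multigraph_def doubleton_eq_iff dest!: bspec[of _ _ e])
  show ?thesis
    using card.remove[OF fin uv(2)] by (simp add: merge_image[OF uv(1) assms(4)])
qed

lemma adjacency_mono:
  "S \<subseteq> T \<Longrightarrow> adjacency (spanning_subgraph G S) \<subseteq> adjacency (spanning_subgraph G T)"
  by (auto simp: adjacency_def)

lemma connected_mono:
  assumes "connected_multigraph (spanning_subgraph G S)" "S \<subseteq> T"
  shows "connected_multigraph (spanning_subgraph G T)"
  using assms rtrancl_mono[OF adjacency_mono[OF assms(2)], of G]
  by (auto simp: connected_multigraph_def)

lemma sym_adjacency: "sym (adjacency G)"
  by (auto simp: sym_def adjacency_def insert_commute)

lemma connected_via_root:
  assumes "r \<in> verts G" "\<And>x. x \<in> verts G \<Longrightarrow> (r, x) \<in> (adjacency G)\<^sup>*"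
  shows "connected_multigraph G"
  unfolding connected_multigraph_def
  using assms symD[OF sym_rtrancl[OF sym_adjacency], of r _ G] by (blast intro: rtrancl_trans)

text \<open>
  An edge between vertices that are joined by a path of other edges can be dropped. This covers
  loops as well as edges on a cycle.
\<close>

lemma connected_redundant:
  assumes conn: "connected_multigraph (spanning_subgraph G (insert e S))"
    and ends: "ends G e = {u, v}" and uv: "(u, v) \<in> (adjacency (spanning_subgraph G S))\<^sup>*"
  shows "connected_multigraph (spanning_subgraph G S)"
proof -
  let ?A = "adjacency (spanning_subgraph G S)"
  have vu: "(v, u) \<in> ?A\<^sup>*" using uv sym_rtrancl[OF sym_adjacency] by (meson symD)
  have "adjacency (spanning_subgraph G (insert e S)) \<subseteq> ?A\<^sup>*"
  proof
    fix p assume "p \<in> adjacency (spanning_subgraph G (insert e S))"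
    then obtain x y f where p: "p = (x, y)" and f: "f \<in> insert e S" "ends G f = {x, y}"
      by (auto simp: adjacency_def)
    show "p \<in> ?A\<^sup>*"
    proof (cases "f \<in> S")
      case True
      then have "(x, y) \<in> ?A" using f by (auto simp: adjacency_def)
      then show ?thesis using p by blast
    next
      case False
      then have "{x, y} = {u, v}" using f ends by auto
      then show ?thesis using p uv vu by (auto simp: doubleton_eq_iff)
    qed
  qed
  then have "(adjacency (spanning_subgraph G (insert e S)))\<^sup>* \<subseteq> ?A\<^sup>*"
    by (rule rtrancl_subset_rtrancl)
  then show ?thesis using conn by (auto simp: connected_multigraph_def)
qed

text \<open>
  Paths in the contracted graph lift to paths in \<open>G\<close>, since the edge \<open>e\<close> connects each vertex with its
  image under the merging map.
\<close>

lemma connected_contract: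
  assumes wf: "wf_multigraph G" and S: "S \<subseteq> edges G" and ends: "ends G e = {u, v}"
  shows "connected_multigraph (spanning_subgraph (contract G e u v) S) \<longleftrightarrow>
    connected_multigraph (spanning_subgraph G (insert e S))"
proof -
  let ?A = "adjacency (spanning_subgraph G (insert e S))"
  let ?B = "adjacency (spanning_subgraph (contract G e u v) S)"
  have fwd: "(merge u v x, merge u v y) \<in> ?B\<^sup>*" if "(x, y) \<in> ?A\<^sup>*" for x y
    using that
  proof (induction rule: rtrancl_induct)
    case (step y z)
    then obtain f where f: "f \<in> insert e S" "ends G f = {y, z}"
      by (auto simp: adjacency_def)
    have "(merge u v y, merge u v z) \<in> ?B\<^sup>*"
    proof (cases "f \<in> S")
      case True
      then have "(merge u v y, merge u v z) \<in> ?B" using f by (auto simp: adjacency_def)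
      then show ?thesis by blast
    next
      case False
      then have "{y, z} = {u, v}" using f ends by auto
      then have "merge u v y = merge u v z" by (auto simp: merge_def doubleton_eq_iff)
      then show ?thesis by simp
    qed
    then show ?case using step.IH by (rule rtrancl_trans[rotated])
  qed simp
  have symA: "sym (?A\<^sup>*)" by (rule sym_rtrancl[OF sym_adjacency])
  have "(u, v) \<in> ?A" using ends by (auto simp: adjacency_def)
  then have mA: "(x, merge u v x) \<in> ?A\<^sup>*" for x
    using symD[OF sym_adjacency \<open>(u, v) \<in> ?A\<close>] by (simp add: merge_def r_into_rtrancl)
  have mA': "(merge u v x, x) \<in> ?A\<^sup>*" for x
    using symD[OF symA mA] .
  have bwd: "?B \<subseteq> ?A\<^sup>*"
  proof
    fix p assume "p \<in> ?B"
    then obtain a b f where p: "p = (a, b)" and f: "f \<in> S" "merge u v ` ends G f = {a, b}"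
      by (auto simp: adjacency_def)
    then obtain x y where xy: "ends G f = {x, y}"
      using wf S unfolding wf_multigraph_def by blast
    have "(x, y) \<in> ?A\<^sup>*" "(y, x) \<in> ?A\<^sup>*"
      using xy f(1) by (auto simp: adjacency_def insert_commute intro!: r_into_rtrancl)
    then have "(merge u v x, merge u v y) \<in> ?A\<^sup>*" "(merge u v y, merge u v x) \<in> ?A\<^sup>*"
      using rtrancl_trans[OF mA'[of x] rtrancl_trans[OF _ mA[of y]]]
        rtrancl_trans[OF mA'[of y] rtrancl_trans[OF _ mA[of x]]] by simp_all
    then show "p \<in> ?A\<^sup>*"
      using f(2) unfolding p xy by (auto simp: doubleton_eq_iff)
  qed
  have iff: "(merge u v x, merge u v y) \<in> ?B\<^sup>* \<longleftrightarrow> (x, y) \<in> ?A\<^sup>*" for x y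
  proof
    assume "(merge u v x, merge u v y) \<in> ?B\<^sup>*"
    then have "(merge u v x, merge u v y) \<in> ?A\<^sup>*"
      using rtrancl_subset_rtrancl[OF bwd] by blast
    then show "(x, y) \<in> ?A\<^sup>*"
      using rtrancl_trans[OF mA[of x] rtrancl_trans[OF _ mA'[of y]]] by simp
  qed (rule fwd)
  show ?thesis
    unfolding connected_multigraph_def using iff by simp
qed

lemma connected_contract_iff:
  assumes "wf_multigraph G" "e \<in> edges G" "ends G e = {u, v}"
  shows "connected_multigraph (contract G e u v) \<longleftrightarrow> connected_multigraph G"
proof -
  have "contract G e u v = spanning_subgraph (contract G e u v) (edges G - {e})"
    by (simp add: spanning_subgraph_def contract_def)
  moreover have "connected_multigraph (spanning_subgraph (contract G e u v) (edges G - {e})) \<longleftrightarrow>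
      connected_multigraph G"
    using connected_contract[OF assms(1) _ assms(3), of "edges G - {e}"] assms(2)
    by (simp add: insert_absorb)
  ultimately show ?thesis by argo
qed

lemma connected_delete_loop:
  assumes "connected_multigraph G" "e \<in> edges G" "ends G e = {v}"
  shows "connected_multigraph (delete G e)"
  using connected_redundant[of G e "edges G - {e}" v v] assms
  by (simp add: insert_absorb delete_def)

lemma connected_if_delete: "connected_multigraph (delete G e) \<Longrightarrow> connected_multigraph G"
  using connected_mono[of G "edges G - {e}" "edges G"] by (simp add: delete_def)

lemma wf_loopless:
  assumes "loopless_multigraph G" "connected_multigraph G"
  shows "wf_multigraph G"
proof -
  have "\<exists>u \<in> verts G. \<exists>v \<in> verts G. ends G e = {u, v}" if "e \<in> edges G" for e
  proof -
    have "ends G e \<subseteq> verts G" "card (ends G e) = 2"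
      using assms(1) that by (auto simp: loopless_multigraph_def)
    then show ?thesis by (auto simp: card_2_iff)
  qed
  then show ?thesis
    using assms by (simp add: wf_multigraph_def loopless_multigraph_def connected_multigraph_def)
qed

lemma loopless_ends:
  assumes "loopless_multigraph G" "e \<in> edges G"
  obtains u v where "ends G e = {u, v}" "u \<noteq> v"
  using assms by (auto simp: loopless_multigraph_def card_2_iff)

section \<open>The h-polynomial\<close>

lemma multigraph_induct [consumes 1, case_names no_edges loop link]:
  assumes "wf_multigraph G"
    and no_edges: "\<And>G. wf_multigraph G \<Longrightarrow> edges G = {} \<Longrightarrow> P G"
    and loop: "\<And>G e v. wf_multigraph G \<Longrightarrow> e \<in> edges G \<Longrightarrow> ends G e = {v} \<Longrightarrow> P (delete G e) \<Longrightarrow> P G"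
    and link: "\<And>G e u v. wf_multigraph G \<Longrightarrow> e \<in> edges G \<Longrightarrow> ends G e = {u, v} \<Longrightarrow> u \<noteq> v \<Longrightarrow>
      P (delete G e) \<Longrightarrow> P (contract G e u v) \<Longrightarrow> P G"
  shows "P G"
  using assms(1)
proof (induction "card (edges G)" arbitrary: G)
  case 0
  then show ?case using no_edges by (auto simp: wf_multigraph_def)
next
  case (Suc m)
  then obtain e where e: "e \<in> edges G" by fastforce
  then obtain u v where uv: "ends G e = {u, v}"
    using Suc.prems unfolding wf_multigraph_def by blast
  have "card (edges G - {e}) = m"
    using Suc.hyps(2) e Suc.prems by (simp add: wf_multigraph_def)
  then have del: "P (delete G e)" and con: "P (contract G e u v)"
    using Suc.hyps(1) Suc.prems by (simp_all add: wf_delete wf_contract)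
  show ?case
  proof (cases "u = v")
    case True
    then show ?thesis using loop[OF Suc.prems e _ del] uv by simp
  next
    case False
    then show ?thesis using link[OF Suc.prems e uv _ del con] by simp
  qed
qed

text \<open>
  Contracting an edge decreases the order and the number of edges by one each, and an edgeless
  connected graph has a single vertex.
\<close>

lemma order_le_Suc_size:
  assumes "wf_multigraph G" "connected_multigraph G"
  shows "graph_order G \<le> Suc (card (edges G))"
  using assms
proof (induction rule: multigraph_induct)
  case (no_edges G)
  have "u = v" if "u \<in> verts G" "v \<in> verts G" for u v
    using that no_edges by (auto simp: connected_multigraph_def adjacency_def)
  then have "\<exists>v. verts G = {v}" using no_edges(1) unfolding wf_multigraph_def by blast
  then show ?case by auto
next
  case (loop G e v)
  have "connected_multigraph (delete G e)"
    by (rule connected_delete_loop[OF loop.prems loop(2,3)])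
  then show ?case using loop.IH card_Diff1_le[of "edges G" e] by simp
next
  case (link G e u v)
  have "connected_multigraph (contract G e u v)"
    using connected_contract_iff[OF link(1-3)] link.prems by simp
  then show ?case
    using link.IH(2) order_contract[OF link(1-4)] card.remove[OF _ link(2)] link(1)
    by (simp add: wf_multigraph_def)
qed

definition connected_sets :: "('v, 'e) multigraph \<Rightarrow> 'e set set" where
  "connected_sets G = {S. S \<subseteq> edges G \<and> connected_multigraph (spanning_subgraph G S)}"

text \<open>
  The quotient of the reliability polynomial by \<open>(1 - q)\<^sup>n\<^sup>-\<^sup>1\<close>, as a real polynomial: the exponent
  \<open>Suc (card S) - graph_order G\<close> is \<open>|S| - (n - 1)\<close>, and this subtraction does not truncate by
  \<open>order_le_Suc_size\<close>. For a connected graph it is the h-polynomial of the independence complex of the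
  cographic matroid.
\<close>

definition hpoly :: "('v, 'e) multigraph \<Rightarrow> real poly" where
  "hpoly G = (\<Sum>S \<in> connected_sets G.
     [:1, -1:] ^ (Suc (card S) - graph_order G) * [:0, 1:] ^ (card (edges G) - card S))"

lemma connected_sets_card:
  assumes "wf_multigraph G" "S \<in> connected_sets G"
  shows "graph_order G \<le> Suc (card S)" "card S \<le> card (edges G)" "finite S"
proof -
  have S: "S \<subseteq> edges G" and fin: "finite (edges G)" and "wf_multigraph (spanning_subgraph G S)"
    using assms by (auto simp: connected_sets_def wf_multigraph_def intro: finite_subset)
  then show "graph_order G \<le> Suc (card S)"
    using order_le_Suc_size[of "spanning_subgraph G S"] assms(2) by (simp add: connected_sets_def)
  show "card S \<le> card (edges G)" "finite S"
    using S fin by (simp_all add: card_mono finite_subset)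
qed

lemma finite_connected_sets: "wf_multigraph G \<Longrightarrow> finite (connected_sets G)"
  by (simp add: connected_sets_def wf_multigraph_def)

lemma sum_connected_sets:
  fixes f :: "'e set \<Rightarrow> 'a :: comm_monoid_add"
  assumes wf: "wf_multigraph G" and e: "e \<in> edges G"
  shows "(\<Sum>S \<in> connected_sets G. f S) = (\<Sum>S \<in> connected_sets (delete G e). f S) +
     (\<Sum>S | S \<subseteq> edges G - {e} \<and> connected_multigraph (spanning_subgraph G (insert e S)). f (insert e S))"
proof -
  let ?C = "{S. S \<subseteq> edges G - {e} \<and> connected_multigraph (spanning_subgraph G (insert e S))}"
  have "connected_sets G = connected_sets (delete G e) \<union> insert e ` ?C" (is "?L = ?R")
  proof (intro equalityI subsetI)
    fix S assume S: "S \<in> ?L"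
    show "S \<in> ?R"
    proof (cases "e \<in> S")
      case True
      then have "S - {e} \<in> ?C" "S = insert e (S - {e})"
        using S by (auto simp: connected_sets_def insert_absorb)
      then show ?thesis by blast
    qed (use S in \<open>auto simp: connected_sets_def\<close>)
  qed (use e in \<open>auto simp: connected_sets_def\<close>)
  moreover have "connected_sets (delete G e) \<inter> insert e ` ?C = {}"
    by (auto simp: connected_sets_def)
  moreover have "finite ?C" using wf by (simp add: wf_multigraph_def)
  moreover have "inj_on (insert e) ?C"
    by (rule inj_onI) (metis (no_types, lifting) Diff_insert_absorb mem_Collect_eq subset_Diff_insert)
  ultimately show ?thesis
    by (simp add: sum.union_disjoint finite_connected_sets wf_delete wf sum.reindex o_def)
qed

text \<open>
  The connected edge sets that avoid \<open>e\<close> are those of \<open>G - e\<close>; they miss one edge more in \<open>G\<close> than in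
  \<open>G - e\<close>, whence the factor \<open>q\<close>. Removing \<open>e\<close> from the others yields the connected edge sets of \<open>G/e\<close>; order and
  cardinality both drop by one, so the terms agree.
\<close>

lemma hpoly_link:
  assumes wf: "wf_multigraph G" and e: "e \<in> edges G" "ends G e = {u, v}" "u \<noteq> v"
  shows "hpoly G = [:0, 1:] * hpoly (delete G e) + hpoly (contract G e u v)"
proof -
  have fin: "finite (edges G)" using wf by (simp add: wf_multigraph_def)
  have cE: "card (edges G) = Suc (card (edges G - {e}))"
    by (rule card.remove[OF fin e(1)])
  have C: "{S. S \<subseteq> edges G - {e} \<and> connected_multigraph (spanning_subgraph G (insert e S))} =
      connected_sets (contract G e u v)"
    using connected_contract[OF wf _ e(2)] unfolding connected_sets_def by auto
  show ?thesis
    unfolding hpoly_def sum_connected_sets[OF wf e(1)] C sum_distrib_left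
  proof (intro arg_cong2[of _ _ _ _ "(+)"] sum.cong refl)
    fix S assume "S \<in> connected_sets (delete G e)"
    from connected_sets_card(2)[OF wf_delete[OF wf] this]
    show "[:1, -1:] ^ (Suc (card S) - graph_order G) * [:0, 1:] ^ (card (edges G) - card S) =
      ([:0, 1:] * ([:1, -1:] ^ (Suc (card S) - graph_order (delete G e)) *
        [:0, 1:] ^ (card (edges (delete G e)) - card S)) :: real poly)"
      by (simp add: cE Suc_diff_le)
  next
    fix S assume S: "S \<in> connected_sets (contract G e u v)"
    then have "e \<notin> S" by (auto simp: connected_sets_def)
    then have "card (insert e S) = Suc (card S)"
      using connected_sets_card(3)[OF wf_contract[OF wf] S] by simp
    then show "[:1, -1:] ^ (Suc (card (insert e S)) - graph_order G) *
        [:0, 1:] ^ (card (edges G) - card (insert e S)) =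
      ([:1, -1:] ^ (Suc (card S) - graph_order (contract G e u v)) *
        [:0, 1:] ^ (card (edges (contract G e u v)) - card S) :: real poly)"
      unfolding order_contract[OF wf e] by (simp add: cE)
  qed
qed

text \<open>
  Adding a loop to a set does not affect whether it is connected, so the two terms of each set add up
  with weights \<open>q\<close> and \<open>1 - q\<close>.
\<close>

lemma hpoly_loop:
  assumes wf: "wf_multigraph G" and e: "e \<in> edges G" "ends G e = {v}"
  shows "hpoly G = hpoly (delete G e)"
proof -
  have fin: "finite (edges G)" using wf by (simp add: wf_multigraph_def)
  have cE: "card (edges G) = Suc (card (edges G - {e}))"
    by (rule card.remove[OF fin e(1)])
  have C: "{S. S \<subseteq> edges G - {e} \<and> connected_multigraph (spanning_subgraph G (insert e S))} =
      connected_sets (delete G e)"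
    using connected_redundant[of G e _ v v] connected_mono[OF _ subset_insertI] e(2)
    unfolding connected_sets_def by auto
  show ?thesis
    unfolding hpoly_def sum_connected_sets[OF wf e(1)] C sum.distrib[symmetric]
  proof (intro sum.cong refl)
    fix S assume S: "S \<in> connected_sets (delete G e)"
    note card = connected_sets_card[OF wf_delete[OF wf] S]
    obtain a where a: "Suc (card S) = graph_order G + a"
      using card(1) by (auto simp: le_iff_add)
    obtain b where b: "card (edges G - {e}) = card S + b"
      using card(2) by (auto simp: le_iff_add)
    have "e \<notin> S" using S by (auto simp: connected_sets_def)
    then have "card (insert e S) = Suc (card S)"
      using card(3) by simp
    then have eqs: "Suc (card S) - graph_order G = a" "card (edges G) - card S = Suc b"
      "Suc (card (insert e S)) - graph_order G = Suc a" "card (edges G) - card (insert e S) = b"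
      using a b cE by simp_all
    have "[:1, -1:] ^ a * [:0, 1:] ^ Suc b + [:1, -1:] ^ Suc a * [:0, 1:] ^ b =
      ([:1, -1:] ^ a * [:0, 1:] ^ b * ([:0, 1:] + [:1, -1:]) :: real poly)"
      by (simp only: power_Suc ring_distribs ac_simps)
    also have "\<dots> = [:1, -1:] ^ a * [:0, 1:] ^ b" by simp
    finally show "[:1, -1:] ^ (Suc (card S) - graph_order G) * [:0, 1:] ^ (card (edges G) - card S) +
      [:1, -1:] ^ (Suc (card (insert e S)) - graph_order G) * [:0, 1:] ^ (card (edges G) - card (insert e S)) =
      ([:1, -1:] ^ (Suc (card S) - graph_order (delete G e)) *
        [:0, 1:] ^ (card (edges (delete G e)) - card S) :: real poly)"
      unfolding eqs by (simp add: a b)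
  qed
qed

lemma hpoly_disconnected: "\<not> connected_multigraph G \<Longrightarrow> hpoly G = 0"
  using connected_mono[of G _ "edges G"] by (auto simp: hpoly_def connected_sets_def intro!: sum.neutral)

lemma reliability_eq_hpoly:
  assumes "wf_multigraph G"
  shows "reliability G = [:1, -1:] ^ (graph_order G - 1) * map_poly of_real (hpoly G)"
proof -
  have pos: "graph_order G \<ge> 1"
    by (rule order_pos[OF assms])
  have "[:1, -1:] ^ card S * [:0, 1:] ^ (card (edges G) - card S) =
     ([:1, -1:] ^ (graph_order G - 1) * map_poly of_real
      ([:1, -1:] ^ (Suc (card S) - graph_order G) * [:0, 1:] ^ (card (edges G) - card S)) :: complex poly)"
    if "S \<in> connected_sets G" for S
  proof -
    have "card S = (graph_order G - 1) + (Suc (card S) - graph_order G)"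
      using connected_sets_card(1)[OF assms that] pos by simp
    then have "[:1, -1:] ^ card S = ([:1, -1:] ^ (graph_order G - 1) *
        [:1, -1:] ^ (Suc (card S) - graph_order G) :: complex poly)"
      by (metis power_add)
    then show ?thesis
      by (simp add: map_poly_of_real_mult map_poly_of_real_power map_poly_pCons mult.assoc)
  qed
  then show ?thesis
    unfolding reliability_def hpoly_def map_poly_of_real_sum sum_distrib_left
    by (simp add: connected_sets_def)
qed

section \<open>Coefficient inequalities\<close>

lemma hpoly_no_edges:
  assumes "wf_multigraph G" "edges G = {}" "connected_multigraph G"
  shows "hpoly G = 1"
proof -
  have "connected_sets G = {{}}"
    using assms(2,3) spanning_subgraph_edges[of G] unfolding connected_sets_def assms(2) by auto
  moreover have "graph_order G = 1"
    using order_le_Suc_size[OF assms(1,3)] assms(1,2) card_gt_0_iff[of "verts G"]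
    by (simp add: wf_multigraph_def)
  ultimately show ?thesis using assms(2) by (simp add: hpoly_def)
qed

lemma coeff_hpoly_link:
  assumes "wf_multigraph G" "e \<in> edges G" "ends G e = {u, v}" "u \<noteq> v"
  shows "coeff (hpoly G) 0 = coeff (hpoly (contract G e u v)) 0"
    "coeff (hpoly G) (Suc i) = coeff (hpoly (delete G e)) i + coeff (hpoly (contract G e u v)) (Suc i)"
  by (simp_all add: hpoly_link[OF assms])

lemma coeff_hpoly_0:
  assumes "wf_multigraph G"
  shows "coeff (hpoly G) 0 = of_bool (connected_multigraph G)"
  using assms
proof (induction rule: multigraph_induct)
  case (no_edges G)
  then show ?case
    using hpoly_no_edges[of G] hpoly_disconnected[of G] by (cases "connected_multigraph G") simp_all
next
  case (loop G e v)
  then show ?case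
    using connected_if_delete[of G e] connected_delete_loop[of G e v] by (auto simp: hpoly_loop)
next
  case (link G e u v)
  then show ?case
    using coeff_hpoly_link(1)[OF link(1-4)] connected_contract_iff[OF link(1-3)]
    by (simp add: wf_contract)
qed

lemma coeff_hpoly_nonneg:
  assumes "wf_multigraph G"
  shows "coeff (hpoly G) i \<ge> 0"
  using assms
proof (induction arbitrary: i rule: multigraph_induct)
  case (no_edges G)
  then show ?case
    using hpoly_no_edges[of G] hpoly_disconnected[of G] by (cases "connected_multigraph G") simp_all
next
  case (loop G e v)
  then show ?case by (simp add: hpoly_loop)
next
  case (link G e u v)
  then show ?case
    using coeff_hpoly_link[OF link(1-4)] by (cases i) simp_all
qed

text \<open>
  For a link \<open>e\<close> the coefficient \<open>h\<^sub>i\<^sub>+\<^sub>1(G) = h\<^sub>i(G - e) + h\<^sub>i\<^sub>+\<^sub>1(G/e)\<close> is compared with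
  \<open>h\<^sub>i(G) = h\<^sub>i\<^sub>-\<^sub>1(G - e) + h\<^sub>i(G/e)\<close>, where the second summand grows at most by the factor \<open>n - 2\<close>. The degree
  \<open>i = 0\<close> is special because \<open>h\<^sub>0(G) = h\<^sub>0(G/e)\<close> has no summand from \<open>G - e\<close>; there \<open>h\<^sub>0(G - e) \<le> h\<^sub>0(G)\<close> suffices.
\<close>

lemma coeff_hpoly_growth:
  assumes "wf_multigraph G"
  shows "coeff (hpoly G) (Suc i) \<le> (real (graph_order G) - 1) * coeff (hpoly G) i"
  using assms
proof (induction arbitrary: i rule: multigraph_induct)
  case (no_edges G)
  have "graph_order G \<ge> 1"
    by (rule order_pos[OF no_edges(1)])
  then show ?case
    using no_edges hpoly_no_edges[of G] hpoly_disconnected[of G]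
    by (cases "connected_multigraph G") simp_all
next
  case (loop G e v)
  then show ?case by (simp add: hpoly_loop)
next
  case (link G e u v)
  let ?D = "delete G e" and ?C = "contract G e u v"
  have wf: "wf_multigraph ?D" "wf_multigraph ?C"
    using link(1) by (simp_all add: wf_delete wf_contract)
  note order = order_contract[OF link(1-4)]
  note coeffs = coeff_hpoly_link[OF link(1-4)]
  have con: "coeff (hpoly ?C) (Suc i) \<le> (real (graph_order G) - 2) * coeff (hpoly ?C) i"
    using link.IH(2)[of i] order by simp
  show ?case
  proof (cases i)
    case 0
    have "coeff (hpoly ?D) 0 \<le> coeff (hpoly G) 0"
      using connected_if_delete[of G e] by (simp add: coeff_hpoly_0 wf link(1))
    then show ?thesis
      using con coeffs by (simp add: 0 algebra_simps)
  next
    case (Suc j)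
    have "coeff (hpoly ?D) (Suc j) \<le> (real (graph_order G) - 1) * coeff (hpoly ?D) j"
      using link.IH(1)[of j] by simp
    then show ?thesis
      using con coeffs coeff_hpoly_nonneg[OF wf(2), of i] by (simp add: Suc algebra_simps)
  qed
qed

text \<open>
  Deleting a bridge contributes nothing, so the bound for the smaller graph \<open>G/e\<close> applies.
\<close>

lemma coeff_hpoly_1_bridge:
  assumes wf: "wf_multigraph G" and e: "e \<in> edges G" "ends G e = {u, v}" "u \<noteq> v"
    and bridge: "\<not> connected_multigraph (delete G e)"
  shows "coeff (hpoly G) 1 \<le> real (graph_order G) - 2"
proof -
  have "coeff (hpoly G) 1 = coeff (hpoly (contract G e u v)) 1"
    using coeff_hpoly_link(2)[OF wf e, of 0] by (simp add: hpoly_disconnected[OF bridge])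
  also have "\<dots> \<le> (real (graph_order G) - 2) * coeff (hpoly (contract G e u v)) 0"
    using coeff_hpoly_growth[OF wf_contract[OF wf], of e u v 0] order_contract[OF wf e] by simp
  also have "\<dots> \<le> real (graph_order G) - 2"
    using order_contract[OF wf e] order_pos[OF wf_contract[OF wf], of e u v] wf
    by (simp add: coeff_hpoly_0 wf_contract)
  finally show ?thesis .
qed

lemma ex_link:
  assumes "wf_multigraph G" "connected_multigraph G" "graph_order G \<ge> 2"
  shows "\<exists>e \<in> edges G. \<exists>u v. ends G e = {u, v} \<and> u \<noteq> v"
proof -
  obtain x y where xy: "x \<in> verts G" "y \<in> verts G" "x \<noteq> y"
    using assms(3) by (meson card_2_iff' obtain_subset_with_card_n subsetD)
  have "\<exists>u v. (u, v) \<in> adjacency G \<and> u \<noteq> v"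
  proof (rule ccontr)
    assume "\<not> ?thesis"
    then have step: "a = b" if "(a, b) \<in> adjacency G" for a b
      using that by blast
    have "(x, y) \<in> (adjacency G)\<^sup>*"
      using xy assms(2) by (simp add: connected_multigraph_def)
    then have "x = y" by induction (auto dest: step)
    then show False using xy(3) by simp
  qed
  then show ?thesis by (auto simp: adjacency_def)
qed

lemma bridge_if_coeff_1_eq_0:
  assumes wf: "wf_multigraph G" and e: "e \<in> edges G" "ends G e = {u, v}" "u \<noteq> v"
    and zero: "coeff (hpoly G) 1 = 0"
  shows "\<not> connected_multigraph (delete G e)"
proof
  assume "connected_multigraph (delete G e)"
  then have "coeff (hpoly (delete G e)) 0 = 1"
    by (simp add: coeff_hpoly_0 wf_delete wf)
  then show False
    using zero coeff_hpoly_link(2)[OF wf e, of 0] coeff_hpoly_nonneg[OF wf_contract[OF wf], of e u v 1]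
    unfolding One_nat_def by linarith
qed

text \<open>
  Read contrapositively, a bridge of \<open>G/e\<close> is also a bridge of \<open>G - e\<close>.
\<close>

lemma connected_delete_contract:
  assumes "wf_multigraph G" "ends G e = {u, v}" "connected_multigraph (delete (delete G e) f)"
  shows "connected_multigraph (delete (contract G e u v) f)"
proof -
  have "connected_multigraph (spanning_subgraph G (insert e (edges G - {e} - {f})))"
    using connected_mono[of G "edges G - {e} - {f}"] assms(3) by (auto simp: delete_def)
  moreover have "edges G - {e} - {f} \<subseteq> edges G" by blast
  ultimately have "connected_multigraph (spanning_subgraph (contract G e u v) (edges G - {e} - {f}))"
    using connected_contract[OF assms(1) _ assms(2), of "edges G - {e} - {f}"] by simp
  then show ?thesis by (simp add: delete_def)
qed

text \<open>
  If \<open>h\<^sub>i\<^sub>+\<^sub>1(G/e) > 0\<close>, then the better factor \<open>n - 2\<close> for \<open>G/e\<close> makes the bound strict. Otherwise only \<open>G - e\<close> contributes,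
  one degree lower, and the induction hypothesis applies unless this degree is \<open>0\<close>. In that case
  \<open>h\<^sub>1(G/e) = 0\<close>; then every link of \<open>G/e\<close> is a bridge, hence \<open>G - e\<close> has a bridge, and \<open>h\<^sub>1(G - e) \<le> n - 2\<close>.
\<close>

lemma coeff_hpoly_growth_strict:
  assumes "wf_multigraph G" "graph_order G \<ge> 3" "coeff (hpoly G) (Suc i) > 0"
  shows "coeff (hpoly G) (Suc (Suc i)) < (real (graph_order G) - 1) * coeff (hpoly G) (Suc i)"
  using assms
proof (induction arbitrary: i rule: multigraph_induct)
  case (no_edges G)
  then show ?case
    using hpoly_no_edges[of G] hpoly_disconnected[of G] by (cases "connected_multigraph G") simp_all
next
  case (loop G e v)
  then show ?case by (simp add: hpoly_loop)
next
  case (link G e u v)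
  let ?D = "delete G e" and ?C = "contract G e u v" and ?n = "real (graph_order G)"
  have wf: "wf_multigraph ?D" "wf_multigraph ?C"
    using link(1) by (simp_all add: wf_delete wf_contract)
  note order = order_contract[OF link(1-4)]
  note coeffs = coeff_hpoly_link(2)[OF link(1-4)]
  have con: "coeff (hpoly ?C) (Suc (Suc i)) \<le> (?n - 2) * coeff (hpoly ?C) (Suc i)"
    using coeff_hpoly_growth[OF wf(2), of "Suc i"] order by simp
  have del: "coeff (hpoly ?D) (Suc i) \<le> (?n - 1) * coeff (hpoly ?D) i"
    using coeff_hpoly_growth[OF wf(1), of i] by simp
  show ?case
  proof (cases "coeff (hpoly ?C) (Suc i) = 0")
    case False
    then have "coeff (hpoly ?C) (Suc i) > 0" using coeff_hpoly_nonneg[OF wf(2), of "Suc i"] by simp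
    then show ?thesis using con del coeffs by (simp add: algebra_simps)
  next
    case True
    then have pos: "coeff (hpoly ?D) i > 0" and le: "coeff (hpoly ?C) (Suc (Suc i)) \<le> 0"
      using link.prems con coeffs by simp_all
    have "coeff (hpoly ?D) (Suc i) < (?n - 1) * coeff (hpoly ?D) i"
    proof (cases i)
      case (Suc j)
      then show ?thesis using link.IH(1)[of j] link.prems pos by simp
    next
      case 0
      have conD: "connected_multigraph ?D"
        using pos 0 by (simp add: coeff_hpoly_0 wf split: if_splits)
      then have "connected_multigraph ?C"
        using connected_if_delete connected_contract_iff link(1-3) by metis
      then obtain f x y where f: "f \<in> edges ?C" "ends ?C f = {x, y}" "x \<noteq> y"
        using ex_link[OF wf(2)] link.prems order by auto
      then have "\<not> connected_multigraph (delete ?C f)"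
        using bridge_if_coeff_1_eq_0[OF wf(2) f] True 0 by simp
      then have "\<not> connected_multigraph (delete ?D f)"
        using connected_delete_contract[OF link(1) link(3)] by blast
      moreover have f': "f \<in> edges G" "f \<in> edges ?D" using f(1) by simp_all
      obtain x' y' where xy': "ends G f = {x', y'}"
        using f'(1) link(1) unfolding wf_multigraph_def by blast
      moreover have "x' \<noteq> y'"
        proof
          assume "x' = y'"
          then have "{x, y} = {merge u v x'}" using f(2) xy' by simp
          then show False using f(3) by blast
        qed
      ultimately have "coeff (hpoly ?D) 1 \<le> ?n - 2"
        using coeff_hpoly_1_bridge[OF wf(1), of f x' y'] f'(2) xy' by simp
      then show ?thesis using 0 conD by (simp add: coeff_hpoly_0 wf)
    qed
    then show ?thesis using True le coeffs by simp
  qed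
qed

section \<open>Cycles\<close>

lemma cycle_sel [simp]:
  "verts (cycle n) = {..<n}" "edges (cycle n) = {..<n}" "ends (cycle n) i = {i, Suc i mod n}"
  by (simp_all add: cycle_def)

lemma spanning_subgraph_cycle [simp]: "spanning_subgraph (cycle n) {..<n} = cycle n"
  by (simp add: spanning_subgraph_def cycle_def)

lemma loopless_cycle:
  assumes "n \<ge> 2"
  shows "loopless_multigraph (cycle n)"
proof -
  have "i \<noteq> Suc i mod n" if "i < n" for i
    using that assms by (cases "Suc i = n") auto
  then show ?thesis using assms by (auto simp: loopless_multigraph_def)
qed

text \<open>
  Walking forward from the successor of \<open>i\<close> reaches every vertex before the edge \<open>i\<close> would be used.
\<close>

lemma connected_cycle_minus_edge:
  assumes i: "i < n"
  shows "connected_multigraph (spanning_subgraph (cycle n) ({..<n} - {i}))" (is "connected_multigraph ?P")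
proof (rule connected_via_root)
  show "Suc i mod n \<in> verts ?P" using i by simp
  have path: "(Suc i mod n, (Suc i + j) mod n) \<in> (adjacency ?P)\<^sup>*" if "j < n" for j
    using that
  proof (induction j)
    case (Suc j)
    let ?k = "(Suc i + j) mod n"
    have "?k \<noteq> i"
    proof
      assume "?k = i"
      then have "(i + Suc j) mod n = i mod n" using i by simp
      then have "n dvd Suc j" by (metis add_diff_cancel_left' le_add1 mod_eq_dvd_iff_nat)
      then show False using Suc.prems by (auto dest: dvd_imp_le)
    qed
    then have "(?k, Suc ?k mod n) \<in> adjacency ?P"
      using i by (auto simp: adjacency_def intro!: bexI[of _ ?k])
    moreover have "Suc ?k mod n = (Suc i + Suc j) mod n" by (simp add: mod_Suc_eq)
    ultimately show ?case using Suc by (metis Suc_lessD rtrancl.rtrancl_into_rtrancl)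
  qed simp
  fix x assume "x \<in> verts ?P"
  then have x: "x < n" by simp
  have "(Suc i + (x + n - Suc i) mod n) mod n = (Suc i + (x + n - Suc i)) mod n"
    by (rule mod_add_right_eq)
  also have "Suc i + (x + n - Suc i) = x + n"
    using i by linarith
  finally have "(Suc i + (x + n - Suc i) mod n) mod n = x"
    using x by simp
  then show "(Suc i mod n, x) \<in> (adjacency ?P)\<^sup>*"
    using path[of "(x + n - Suc i) mod n"] i by (metis less_nat_zero_code mod_less_divisor neq0_conv)
qed

lemma connected_cycle: "n > 0 \<Longrightarrow> connected_multigraph (cycle n)"
  using connected_mono[OF connected_cycle_minus_edge[of 0 n], of "{..<n}"] by simp

text \<open>
  A connected edge set has at least \<open>n - 1\<close> elements, so it lacks at most one edge of the cycle. The whole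
  edge set contributes \<open>1 - q\<close> and each of the \<open>n\<close> other sets contributes \<open>q\<close>.
\<close>

lemma hpoly_cycle:
  assumes n: "n \<ge> 2"
  shows "hpoly (cycle n) = [:1, real n - 1:]"
proof -
  have conn: "connected_multigraph (cycle n)" using connected_cycle n by simp
  have wf: "wf_multigraph (cycle n)"
    using wf_loopless[OF loopless_cycle[OF n] conn] .
  let ?f = "\<lambda>i. {..<n} - {i}"
  have "connected_sets (cycle n) = insert {..<n} (?f ` {..<n})" (is "?L = ?R")
  proof (intro equalityI subsetI)
    fix S assume S: "S \<in> ?L"
    then have sub: "S \<subseteq> {..<n}" by (simp add: connected_sets_def)
    have "card ({..<n} - S) \<le> 1"
      using connected_sets_card[OF wf S] sub by (simp add: card_Diff_subset)
    then have "{..<n} - S = {} \<or> (\<exists>i. {..<n} - S = {i})"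
      by (metis One_nat_def card_1_singletonE card_eq_0_iff finite_Diff finite_lessThan le_SucE le_zero_eq)
    then show "S \<in> ?R" using sub by blast
  next
    fix S assume "S \<in> ?R"
    then show "S \<in> ?L"
      using conn connected_cycle_minus_edge
      by (auto simp: connected_sets_def)
  qed
  moreover have "inj_on ?f {..<n}" by (rule inj_onI) blast
  moreover have "{..<n} \<notin> ?f ` {..<n}" by blast
  ultimately have "hpoly (cycle n) = [:1, -1:] + (\<Sum>i<n. [:0, 1:])"
    using n by (simp add: hpoly_def sum.reindex card_Diff_subset Suc_diff_le)
  then show ?thesis by (simp add: of_nat_poly)
qed

lemma root_cycle_iff:
  assumes n: "n \<ge> 2"
  shows "reliability_root (cycle n) z \<longleftrightarrow> z = 1 \<or> z = - (1 / (of_nat n - 1))"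
proof -
  have wf: "wf_multigraph (cycle n)"
    using wf_loopless[OF loopless_cycle[OF n]] connected_cycle n by simp
  have "complex_of_nat n \<noteq> 1" using n by auto
  then have "1 + z * (of_nat n - 1) = 0 \<longleftrightarrow> z = - (1 / (of_nat n - 1))"
    by (auto simp: field_simps eq_neg_iff_add_eq_0)
  moreover have "poly (reliability (cycle n)) z = (1 - z) ^ (n - 1) * (1 + z * (of_nat n - 1))"
    unfolding reliability_eq_hpoly[OF wf] hpoly_cycle[OF n] by (simp add: map_poly_pCons algebra_simps)
  ultimately show ?thesis
    using n by (simp add: reliability_root_def eq_commute[of 1])
qed

lemma relpow_segment:
  assumes "\<And>i. i < k \<Longrightarrow> (p i, p (Suc i)) \<in> R" "a \<le> b" "b \<le> k"
  shows "(p a, p b) \<in> R ^^ (b - a)"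
  unfolding relpow_fun_conv
  using assms by (intro exI[of _ "\<lambda>i. p (a + i)"]) auto

text \<open>
  If a walk of minimal length visited a vertex twice, cutting out the part in between would give a
  shorter walk.
\<close>

lemma shortest_path:
  assumes "(u, v) \<in> R\<^sup>*"
  obtains p k where "p 0 = u" "p k = v" "\<And>i. i < k \<Longrightarrow> (p i, p (Suc i)) \<in> R" "inj_on p {..k::nat}"
proof -
  define k where "k = (LEAST k. (u, v) \<in> R ^^ k)"
  have "\<exists>k. (u, v) \<in> R ^^ k" using assms by (simp add: rtrancl_power)
  then have "(u, v) \<in> R ^^ k" unfolding k_def by (rule LeastI_ex)
  then obtain p where p: "p 0 = u" "p k = v" "\<And>i. i < k \<Longrightarrow> (p i, p (Suc i)) \<in> R"
    unfolding relpow_fun_conv by blast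
  have "p i \<noteq> p j" if ij: "i < j" "j \<le> k" for i j
  proof
    assume eq: "p i = p j"
    have "(u, p i) \<in> R ^^ i"
      using relpow_segment[of k p R 0 i] p ij by simp
    moreover have "(p i, v) \<in> R ^^ (k - j)"
      unfolding eq using relpow_segment[of k p R j k] p ij by simp
    ultimately have "(u, v) \<in> R ^^ (i + (k - j))"
      by (auto simp: relpow_add)
    moreover have "i + (k - j) < k" using ij by simp
    ultimately show False unfolding k_def using not_less_Least by blast
  qed
  then have "inj_on p {..k}"
    by (metis atMost_iff inj_onI linorder_neqE_nat)
  then show thesis using that p by blast
qed

lemma cycle_iso_of_enumeration:
  assumes p: "bij_betw p {..<n} (verts G)" and q: "bij_betw q {..<n} (edges G)"
    and ends: "\<And>i. i < n \<Longrightarrow> ends G (q i) = {p i, p (Suc i mod n)}"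
  shows "multigraph_iso G (cycle n)"
  unfolding multigraph_iso_def
proof (intro exI conjI ballI)
  show "bij_betw (the_inv_into {..<n} p) (verts G) (verts (cycle n))"
    "bij_betw (the_inv_into {..<n} q) (edges G) (edges (cycle n))"
    using p q by (simp_all add: cycle_def bij_betw_the_inv_into)
  fix e assume "e \<in> edges G"
  then obtain i where i: "i < n" "e = q i"
    using q by (auto simp: bij_betw_def)
  have "the_inv_into {..<n} q e = i" "the_inv_into {..<n} p (p i) = i"
    "the_inv_into {..<n} p (p (Suc i mod n)) = Suc i mod n"
    using i p q by (auto simp: bij_betw_def intro!: the_inv_into_f_f)
  then show "ends (cycle n) (the_inv_into {..<n} q e) = the_inv_into {..<n} p ` ends G e"
    by (simp add: cycle_def i ends)
qed

text \<open>
  A shortest path from \<open>u\<close> to \<open>v\<close> that avoids \<open>e\<close> exists because \<open>e\<close> is not a bridge. It closes with \<open>e\<close> to a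
  cycle. An edge \<open>f\<close> off this cycle could be deleted without disconnecting \<open>G\<close>, and \<open>e\<close> after it, because
  \<open>e\<close> lies on a cycle that avoids \<open>f\<close>; this contradicts the minimality of \<open>G - e\<close>. So the cycle contains all
  edges, and by connectedness all vertices.
\<close>

lemma minimally_bridgeless_iso_cycle:
  assumes wf: "wf_multigraph G" and conn: "connected_multigraph G"
    and e: "e \<in> edges G" "ends G e = {u, v}" "u \<noteq> v"
    and bridgeless: "\<And>f. f \<in> edges G \<Longrightarrow> connected_multigraph (delete G f)"
    and minimal: "\<And>f. f \<in> edges G \<Longrightarrow> f \<noteq> e \<Longrightarrow> \<not> connected_multigraph (delete (delete G e) f)"
  shows "multigraph_iso G (cycle (graph_order G))"
proof -
  let ?A = "adjacency (delete G e)"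
  have uv: "u \<in> verts G" "v \<in> verts G"
    using wf e by (auto simp: wf_multigraph_def doubleton_eq_iff dest!: bspec[of _ _ e])
  then have "(u, v) \<in> ?A\<^sup>*"
    using bridgeless[OF e(1)] by (simp add: connected_multigraph_def)
  then obtain p k where p: "p 0 = u" "p k = v" "\<And>i. i < k \<Longrightarrow> (p i, p (Suc i)) \<in> ?A"
    and inj: "inj_on p {..k}"
    by (rule shortest_path) blast
  have "\<exists>f. f \<in> edges G \<and> f \<noteq> e \<and> ends G f = {p i, p (Suc i)}" if "i < k" for i
    using p(3)[OF that] by (auto simp: adjacency_def)
  then obtain g where g: "\<And>i. i < k \<Longrightarrow> g i \<in> edges G \<and> g i \<noteq> e \<and> ends G (g i) = {p i, p (Suc i)}"
    by metis
  have path_edges: "f \<in> g ` {..<k}" if f: "f \<in> edges G" "f \<noteq> e" for f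
  proof (rule ccontr)
    assume nf: "f \<notin> g ` {..<k}"
    let ?S = "edges G - {e} - {f}"
    have steps: "(p i, p (Suc i)) \<in> adjacency (spanning_subgraph G ?S)" if "i < k" for i
      using g[OF that] nf that by (auto simp: adjacency_def intro!: bexI[of _ "g i"])
    have "(p 0, p k) \<in> (adjacency (spanning_subgraph G ?S)) ^^ (k - 0)"
      by (rule relpow_segment[where k = k]) (use steps in auto)
    then have reach: "(u, v) \<in> (adjacency (spanning_subgraph G ?S))\<^sup>*"
      unfolding p(1,2) by (rule relpow_imp_rtrancl)
    have "edges G - {f} = insert e ?S" using e(1) f(2) by blast
    then have "connected_multigraph (spanning_subgraph G (insert e ?S))"
      using bridgeless[OF f(1)] by (simp add: delete_def)
    then have "connected_multigraph (spanning_subgraph G ?S)"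
      using e(2) reach by (rule connected_redundant)
    then show False using minimal[OF f] by (simp add: delete_def)
  qed
  \<comment> \<open>the edges in cyclic order, with \<open>e\<close> closing the path from \<open>p k = v\<close> back to \<open>p 0 = u\<close>\<close>
  define q where "q = g(k := e)"
  have q_ends: "ends G (q i) = {p i, p (Suc i mod Suc k)}" if "i < Suc k" for i
  proof (cases "i = k")
    case True
    then show ?thesis using e(2) p(1,2) by (auto simp: q_def)
  next
    case False
    then show ?thesis using g[of i] that by (simp add: q_def)
  qed
  have q_img: "q ` {..<Suc k} = edges G"
  proof (intro equalityI subsetI)
    fix f assume "f \<in> edges G"
    then show "f \<in> q ` {..<Suc k}"
      using path_edges[of f] by (cases "f = e") (auto simp: q_def image_iff)
  qed (use g e(1) in \<open>auto simp: q_def\<close>)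
  have q_inj: "inj_on q {..<Suc k}"
  proof (rule inj_onI)
    have *: "i = j" if "i < k" "j < k" "g i = g j" for i j
    proof -
      have "{p i, p (Suc i)} = {p j, p (Suc j)}" using g[OF that(1)] g[OF that(2)] that(3) by metis
      then have "p i = p j \<or> p i = p (Suc j) \<and> p (Suc i) = p j" by (auto simp: doubleton_eq_iff)
      moreover have "p a = p b \<longleftrightarrow> a = b" if "a \<le> k" "b \<le> k" for a b
        using inj that by (simp add: inj_on_eq_iff)
      ultimately show ?thesis using that by force
    qed
    fix i j assume "i \<in> {..<Suc k}" "j \<in> {..<Suc k}" "q i = q j"
    then show "i = j" using *[of i j] g[of i] g[of j] by (auto simp: q_def less_Suc_eq)
  qed
  have closed: "y \<in> p ` {..<Suc k}" if "(x, y) \<in> adjacency G" for x y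
  proof -
    obtain f where "f \<in> edges G" "ends G f = {x, y}" using \<open>(x, y) \<in> adjacency G\<close>
      by (auto simp: adjacency_def)
    then obtain i where i: "i < Suc k" "{x, y} = {p i, p (Suc i mod Suc k)}"
      using q_img q_ends by (metis imageE lessThan_iff)
    then have "y = p i \<or> y = p (Suc i mod Suc k)" by blast
    then show ?thesis using i(1) by auto
  qed
  have p_verts: "p i \<in> verts G" if "i < Suc k" for i
  proof -
    have "q i \<in> edges G" using q_img that by blast
    then have "ends G (q i) \<subseteq> verts G" using wf unfolding wf_multigraph_def by fastforce
    then show ?thesis using q_ends[OF that] by blast
  qed
  have p_img: "p ` {..<Suc k} = verts G"
  proof (intro equalityI subsetI)
    fix x assume "x \<in> verts G"
    then have "(u, x) \<in> (adjacency G)\<^sup>*"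
      using uv conn by (simp add: connected_multigraph_def)
    then show "x \<in> p ` {..<Suc k}"
    proof induction
      case base
      then show ?case using p(1) by force
    next
      case (step y z)
      then show ?case using closed by blast
    qed
  qed (use p_verts in blast)
  have p_inj: "inj_on p {..<Suc k}" using inj by (simp only: lessThan_Suc_atMost)
  have "graph_order G = Suc k"
    using card_image[OF p_inj] by (simp only: p_img card_lessThan)
  then show ?thesis
    using cycle_iso_of_enumeration[of p "Suc k" G q] p_inj p_img q_inj q_img q_ends
    by (simp add: bij_betw_def)
qed

section \<open>Roots of smallest modulus\<close>

text \<open>
  The equality case of the Enestrom-Kakeya bound, in combination with the strict growth of the
  coefficients in positive degrees, leaves only the polynomial \<open>1 + (n - 1) q\<close>.
\<close>

lemma small_root_imp_hpoly_linear:
  assumes loopless: "loopless_multigraph G" and conn: "connected_multigraph G"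
    and n: "graph_order G \<ge> 3" and root: "reliability_root G z"
    and small: "cmod z \<le> 1 / (real (graph_order G) - 1)"
  shows "hpoly G = [:1, real (graph_order G) - 1:]" "z = - (1 / (of_nat (graph_order G) - 1))"
proof -
  define K where "K = real (graph_order G) - 1"
  define w where "w = of_real K * z"
  have K: "K \<ge> 2" using n by (simp add: K_def)
  note wf = wf_loopless[OF loopless conn]
  have nonneg: "coeff (hpoly G) i \<ge> 0" for i
    by (rule coeff_hpoly_nonneg[OF wf])
  have growth: "coeff (hpoly G) (Suc i) \<le> K * coeff (hpoly G) i" for i
    unfolding K_def by (rule coeff_hpoly_growth[OF wf])
  have strict: "coeff (hpoly G) (Suc (Suc i)) < K * coeff (hpoly G) (Suc i)"
    if "coeff (hpoly G) (Suc i) > 0" for i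
    unfolding K_def using coeff_hpoly_growth_strict[OF wf n that] .
  have one: "coeff (hpoly G) 0 = 1"
    by (simp add: coeff_hpoly_0 wf conn)
  have "z \<noteq> 1"
    using small K by (auto simp: K_def[symmetric] field_simps)
  then have root': "poly (map_poly of_real (hpoly G)) z = 0"
    using root by (simp add: reliability_root_def reliability_eq_hpoly[OF wf])
  have boundary: "w ^ Suc i = 1" if "coeff (hpoly G) (Suc i) < K * coeff (hpoly G) i" for i
    unfolding w_def using Enestrom_Kakeya_boundary[OF _ growth one root' _ that] K small
    by (simp add: K_def)
  \<comment> \<open>otherwise \<open>z = 1/K\<close> would be a positive real, where the polynomial is positive\<close>
  have "w \<noteq> 1"
  proof
    assume "w = 1"
    then have "z = of_real (1 / K)" using K by (simp add: w_def field_simps)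
    then have "complex_of_real (\<Sum>i\<le>degree (hpoly G). coeff (hpoly G) i * (1 / K) ^ i) = 0"
      using root' by (simp add: poly_of_real_sum)
    then have "(\<Sum>i\<le>degree (hpoly G). coeff (hpoly G) i * (1 / K) ^ i) = 0"
      by (simp only: of_real_eq_0_iff)
    then have "coeff (hpoly G) 0 * (1 / K) ^ 0 = 0"
      using nonneg K by (subst (asm) sum_nonneg_eq_0_iff) auto
    then show False using one by simp
  qed
  \<comment> \<open>a strict inequality in degree \<open>0\<close> would give \<open>w = 1\<close>\<close>
  then have h1: "coeff (hpoly G) (Suc 0) = K"
    using boundary[of 0] growth[of 0] one by force
  then have "w ^ 2 = 1"
    using boundary[of 1] strict[of 0] K by (simp add: numeral_2_eq_2)
  then have "w ^ 3 \<noteq> 1"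
    using \<open>w \<noteq> 1\<close> by (simp add: power3_eq_cube power2_eq_square)
  \<comment> \<open>a positive coefficient would make the bound in degree \<open>2\<close> strict and give \<open>w\<^sup>3 = 1\<close>\<close>
  then have h2: "coeff (hpoly G) (Suc (Suc 0)) = 0"
    using boundary[of 2] strict[of 1] nonneg[of 2] by (force simp: numeral_3_eq_3 numeral_2_eq_2)
  have "coeff (hpoly G) (Suc (Suc i)) = 0" for i
  proof (induction i)
    case (Suc i)
    then show ?case using growth[of "Suc (Suc i)"] nonneg[of "Suc (Suc (Suc i))"] by simp
  qed (rule h2)
  then show H: "hpoly G = [:1, real (graph_order G) - 1:]"
    using one h1 by (intro poly_eqI) (auto simp: K_def coeff_pCons split: nat.splits)
  then have "1 + of_real K * z = 0"
    using root' by (simp add: map_poly_pCons K_def algebra_simps)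
  then have "of_real K * z = -1" by (simp add: eq_neg_iff_add_eq_0 add.commute)
  then have "z = - (1 / of_real K)" using K by (simp add: field_simps)
  then show "z = - (1 / (of_nat (graph_order G) - 1))" by (simp add: K_def)
qed

text \<open>
  The coefficient \<open>h\<^sub>1 = n - 1\<close> excludes bridges. Since \<open>h\<^sub>2 = 0\<close>, the summand \<open>h\<^sub>1(G - e)\<close> of \<open>h\<^sub>2\<close> vanishes, so all edges
  of \<open>G - e\<close> are bridges.
\<close>

lemma hpoly_linear_iso_cycle:
  assumes loopless: "loopless_multigraph G" and conn: "connected_multigraph G"
    and n: "graph_order G \<ge> 2" and hpoly: "hpoly G = [:1, real (graph_order G) - 1:]"
  shows "multigraph_iso G (cycle (graph_order G))"
proof -
  note wf = wf_loopless[OF loopless conn]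
  obtain e u v where e: "e \<in> edges G" "ends G e = {u, v}" "u \<noteq> v"
    using ex_link[OF wf conn n] by blast
  show ?thesis
  proof (rule minimally_bridgeless_iso_cycle[OF wf conn e])
    fix f assume f: "f \<in> edges G"
    obtain x y where xy: "ends G f = {x, y}" "x \<noteq> y"
      by (rule loopless_ends[OF loopless f])
    show "connected_multigraph (delete G f)"
      using coeff_hpoly_1_bridge[OF wf f xy] hpoly by force
    assume "f \<noteq> e"
    have "coeff (hpoly G) 2 = 0" by (simp add: hpoly numeral_2_eq_2)
    then have "coeff (hpoly (delete G e)) 1 = 0"
      using coeff_hpoly_link(2)[OF wf e, of 1] coeff_hpoly_nonneg[OF wf_delete[OF wf], of e 1]
        coeff_hpoly_nonneg[OF wf_contract[OF wf], of e u v 2]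
      by (simp add: numeral_2_eq_2)
    then show "\<not> connected_multigraph (delete (delete G e) f)"
      using f \<open>f \<noteq> e\<close> xy by (intro bridge_if_coeff_1_eq_0[OF wf_delete[OF wf], of f e x y]) simp_all
  qed
qed

lemma small_root_imp_iso_cycle:
  assumes loopless: "loopless_multigraph G" and conn: "connected_multigraph G"
    and n: "graph_order G \<ge> 3" and root: "reliability_root G z"
    and small: "cmod z \<le> 1 / (real (graph_order G) - 1)"
  shows "multigraph_iso G (cycle (graph_order G))"
  by (rule hpoly_linear_iso_cycle[OF loopless conn _ small_root_imp_hpoly_linear(1)[OF assms]]) (use n in simp)

section \<open>Graphs of order two\<close>

text \<open>
  All edges join the same two vertices, so every nonempty edge set is connected. The sum over all
  edge sets is \<open>(1 - q + q)\<^sup>m = 1\<close>, from which the term \<open>q\<^sup>m\<close> of the empty set is subtracted.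
\<close>

lemma reliability_order_2:
  assumes loopless: "loopless_multigraph G" and conn: "connected_multigraph G"
    and two: "graph_order G = 2"
  shows "edges G \<noteq> {}" "reliability G = 1 - [:0, 1:] ^ card (edges G)"
proof -
  have ends: "ends G e = verts G" if "e \<in> edges G" for e
    using loopless that two by (intro card_subset_eq) (auto simp: loopless_multigraph_def)
  have fin: "finite (edges G)" using loopless by (simp add: loopless_multigraph_def)
  obtain a b where ab: "verts G = {a, b}" "a \<noteq> b" using two by (auto simp: card_2_iff)
  have connected_iff: "connected_multigraph (spanning_subgraph G S) \<longleftrightarrow> S \<noteq> {}" if S: "S \<subseteq> edges G" for S
  proof
    assume "connected_multigraph (spanning_subgraph G S)"
    then have "(a, b) \<in> (adjacency (spanning_subgraph G S))\<^sup>*"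
      using ab(1) by (simp add: connected_multigraph_def)
    then show "S \<noteq> {}" using ab(2) by (auto simp: adjacency_def)
  next
    assume "S \<noteq> {}"
    then obtain e where e: "e \<in> S" by blast
    then have "(x, y) \<in> adjacency (spanning_subgraph G S)" if "{x, y} = verts G" for x y
      using that S ends[of e] by (auto simp: adjacency_def)
    then show "connected_multigraph (spanning_subgraph G S)"
      by (intro connected_via_root[of a]) (auto simp: ab(1))
  qed
  show "edges G \<noteq> {}" using connected_iff[of "edges G"] conn by simp
  have sets: "{S. S \<subseteq> edges G \<and> connected_multigraph (spanning_subgraph G S)} = Pow (edges G) - {{}}"
    using connected_iff by auto
  have "(\<Sum>S \<in> Pow (edges G). [:1, -1:] ^ card S * [:0, 1:] ^ (card (edges G) - card S)) =
      (\<Sum>S \<in> Pow (edges G). (\<Prod>e\<in>S. [:1, -1:]) * (\<Prod>e\<in>edges G - S. [:0, 1:]) :: complex poly)"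
    using fin by (intro sum.cong) (auto simp: card_Diff_subset finite_subset)
  also have "\<dots> = (\<Prod>e\<in>edges G. [:1, -1:] + [:0, 1:])"
    by (rule prod_add[OF fin, symmetric])
  also have "\<dots> = 1" proof -
    have "[:1, -1:] + [:0, 1:] = (1 :: complex poly)" by (simp add: one_pCons)
    then show ?thesis by (simp only: prod.neutral_const)
  qed
  finally show "reliability G = 1 - [:0, 1:] ^ card (edges G)"
    unfolding reliability_def sets using fin by (simp add: sum_diff1)
qed

lemma root_of_order_2_iff: "root_of_order 2 z \<longleftrightarrow> (\<exists>m :: nat. m \<ge> 1 \<and> z ^ m = 1)"
proof
  assume "root_of_order 2 z"
  then obtain G :: "(nat, nat) multigraph" where G: "loopless_multigraph G" "connected_multigraph G"
    "graph_order G = 2" "reliability_root G z"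
    by (auto simp: root_of_order_def)
  have "card (edges G) \<ge> 1"
    using G(1) reliability_order_2(1)[OF G(1-3)]
    by (simp add: loopless_multigraph_def Suc_le_eq card_gt_0_iff)
  moreover have "z ^ card (edges G) = 1"
    using G(4) by (simp add: reliability_root_def reliability_order_2(2)[OF G(1-3)])
  ultimately show "\<exists>m :: nat. m \<ge> 1 \<and> z ^ m = 1" by blast
next
  assume "\<exists>m :: nat. m \<ge> 1 \<and> z ^ m = 1"
  then obtain m :: nat where m: "m \<ge> 1" "z ^ m = 1" by blast
  let ?G = "\<lparr>verts = {0, 1}, edges = {..<m}, ends = (\<lambda>_. {0, 1})\<rparr> :: (nat, nat) multigraph"
  have loopless: "loopless_multigraph ?G" by (simp add: loopless_multigraph_def)
  have "(0, 1) \<in> adjacency ?G" using m(1) by (auto simp: adjacency_def intro!: exI[of _ "0 :: nat"])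
  then have conn: "connected_multigraph ?G"
    by (intro connected_via_root[of 0]) auto
  have two: "graph_order ?G = 2" by simp
  have "reliability_root ?G z"
    unfolding reliability_root_def reliability_order_2(2)[OF loopless conn two] using m(2) by simp
  then show "root_of_order 2 z"
    using loopless conn two unfolding root_of_order_def by blast
qed

lemma smallest_root_of_order_2_iff:
  "smallest_root_of_order 2 z \<longleftrightarrow> (\<exists>m :: nat. m \<ge> 1 \<and> z ^ m = 1)"
proof -
  have unit: "cmod z = 1" if root: "root_of_order 2 z" for z
  proof -
    obtain m :: nat where m: "m \<ge> 1" "z ^ m = 1"
      using root unfolding root_of_order_2_iff by blast
    have "cmod (z ^ m) = 1" unfolding m(2) by (rule norm_one)
    then have "cmod z ^ m = 1 ^ m" unfolding norm_power power_one .
    then show ?thesis by (rule power_eq_imp_eq_base) (use m(1) in auto)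
  qed
  moreover have "root_of_order 2 1" unfolding root_of_order_2_iff by (intro exI[of _ 1]) simp
  ultimately have "{cmod z | z. root_of_order 2 z} = {1}" by force
  then have "min_root_modulus 2 = 1" by (simp add: min_root_modulus_def)
  then show ?thesis
    using unit by (auto simp: smallest_root_of_order_def root_of_order_2_iff)
qed

section \<open>The minimum modulus\<close>

theorem corollary2p3:
  fixes n :: nat
  shows "(n \<ge> 3 \<longrightarrow>
            min_root_modulus n = 1 / (real n - 1) \<and>
            (\<exists>z. smallest_root_of_order n z) \<and>
            (\<forall>G :: ('v, 'e) multigraph. loopless_multigraph G \<and> connected_multigraph G \<and> graph_order G = n \<longrightarrow>
               ((\<exists>z. reliability_root G z \<and> cmod z = min_root_modulus n) \<longleftrightarrow> multigraph_iso G (cycle n))) \<and>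
            {z. reliability_root (cycle n) z \<and> cmod z = min_root_modulus n} = {- (1 / (of_nat n - 1))}) \<and>
         {z. smallest_root_of_order 2 z} = {z :: complex. \<exists>m :: nat. m \<ge> 1 \<and> z ^ m = 1}"
proof (intro conjI impI)
  show "{z. smallest_root_of_order 2 z} = {z :: complex. \<exists>m :: nat. m \<ge> 1 \<and> z ^ m = 1}"
    by (simp add: smallest_root_of_order_2_iff)
  assume n: "n \<ge> 3"
  let ?r = "1 / (real n - 1)" and ?z = "- (1 / (of_nat n - 1)) :: complex"
  have cycle: "loopless_multigraph (cycle n)" "connected_multigraph (cycle n)"
    "reliability_root (cycle n) ?z"
    using n by (simp_all add: loopless_cycle connected_cycle root_cycle_iff)
  have "?z = of_real (- ?r)" by simp
  then have "cmod ?z = \<bar>- ?r\<bar>" by (simp only: norm_of_real)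
  then have norm_z: "cmod ?z = ?r" using n by simp
  have root_z: "root_of_order n ?z"
    using root_of_orderI[OF cycle] by simp
  have bound: "?r \<le> cmod w" if w: "root_of_order n w" for w
  proof (rule ccontr)
    assume less: "\<not> ?r \<le> cmod w"
    obtain G :: "(nat, nat) multigraph" where G: "loopless_multigraph G" "connected_multigraph G"
      "graph_order G = n" "reliability_root G w"
      using w unfolding root_of_order_def by blast
    then have "w = ?z"
      using small_root_imp_hpoly_linear(2)[of G w] n less by simp
    then show False using less norm_z by simp
  qed
  show min: "min_root_modulus n = ?r"
    unfolding min_root_modulus_def
  proof (rule cInf_eq_minimum)
    show "?r \<in> {cmod z | z. root_of_order n z}" using root_z norm_z by force
  qed (use bound in blast)
  show "\<exists>z. smallest_root_of_order n z"
    using root_z norm_z min unfolding smallest_root_of_order_def by metis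
  show "\<forall>G :: ('v, 'e) multigraph. loopless_multigraph G \<and> connected_multigraph G \<and> graph_order G = n \<longrightarrow>
      ((\<exists>z. reliability_root G z \<and> cmod z = min_root_modulus n) \<longleftrightarrow> multigraph_iso G (cycle n))"
  proof (intro allI impI iffI)
    fix G :: "('v, 'e) multigraph"
    assume G: "loopless_multigraph G \<and> connected_multigraph G \<and> graph_order G = n"
    show "multigraph_iso G (cycle n)" if "\<exists>z. reliability_root G z \<and> cmod z = min_root_modulus n"
      using that small_root_imp_iso_cycle[of G] G n min by auto
    assume iso: "multigraph_iso G (cycle n)"
    then have "reliability_root G ?z"
      using multigraph_iso_invariance(4)[OF iso] G cycle(3) by (simp add: reliability_root_def)
    then show "\<exists>z. reliability_root G z \<and> cmod z = min_root_modulus n"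
      using norm_z min by metis
  qed
  have "?r \<noteq> 1" using n by (simp add: field_simps)
  then show "{z. reliability_root (cycle n) z \<and> cmod z = min_root_modulus n} = {?z}"
    using n norm_z min root_cycle_iff[of n] by auto
qed

end
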